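(* Let $A\in\mathbb{Z}^{m\times n}$ with $m\ge n$ have full column rank, let $b\in\mathbb{R}^m$, and let $P=P(A,b)=\{x\in\mathbb{R}^n: Ax\le b\}$ be a polytope such that every row of $A$ defines a facet of $P$. Suppose $P$ is $\Delta$-modular, i.e. $\Delta=\Delta(A)$. Then $$w^{\mathcal{F}}(P)\le\Delta\, w(P).$$
   Context: $\Delta(A)$ is the maximum absolute value of an $n\times n$ minor of $A$. The lattice width is $w(P)=\min_{z\in\mathbb{Z}^n\setminus\{0\}}\big(\max_{x\in P}z^Tx-\min_{y\in P}z^Ty\big)$. $\mathcal{F}$ is the set of facet normals of $P$, here the set of (transposed) rows of $A$, and the facet width is $w^{\mathcal{F}}(P)=\min_{z\in\mathcal{F}}\big(\max_{x\in P}z^Tx-\min_{y\in P}z^Ty\big)$. *)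

theory Defs
  imports "HOL-Analysis.Analysis"
begin

abbreviation real_matrix :: "int^'n^'m \<Rightarrow> real^'n^'m"
  where "real_matrix \<equiv> map_matrix of_int"

definition polyhedron_of :: "int^'n^'m \<Rightarrow> real^'m \<Rightarrow> (real^'n) set"
  where "polyhedron_of A b = {x. \<forall>i. (real_matrix A *v x) $ i \<le> b $ i}"

definition row_face :: "int^'n^'m \<Rightarrow> real^'m \<Rightarrow> 'm \<Rightarrow> (real^'n) set"
  where "row_face A b i = {x \<in> polyhedron_of A b. (real_matrix A *v x) $ i = b $ i}"

(* An n x n submatrix is given by an injective choice f of n rows. Different
   enumerations of the same rows only change the sign of the determinant. *)
definition max_minor :: "int^'n^'m \<Rightarrow> int"
  where "max_minor A = Max {\<bar>det (\<chi> i. row (f i) A)\<bar> | f :: 'n \<Rightarrow> 'm. inj f}"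

(* On a nonempty compact P, Sup and Inf are the maximum and minimum of the linear
   functional. *)
definition width_along :: "real^'n \<Rightarrow> (real^'n) set \<Rightarrow> real"
  where "width_along z P = (SUP x\<in>P. z \<bullet> x) - (INF y\<in>P. z \<bullet> y)"

(* The infimum is a minimum if Z is finite and nonempty, and also if Z is the set of
   nonzero integer vectors and P is a full-dimensional polytope: then only finitely
   many integer vectors z satisfy width_along z P \<le> c, for any c. *)
definition min_width :: "(real^'n) set \<Rightarrow> (real^'n) set \<Rightarrow> real"
  where "min_width Z P = (INF z\<in>Z. width_along z P)"

definition lattice_width :: "(real^'n) set \<Rightarrow> real"
  where "lattice_width P = min_width {z. (\<forall>i. z $ i \<in> \<int>) \<and> z \<noteq> 0} P"

(* The normals are the rows of A themselves, not rescaled to primitive vectors. *)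
definition facet_width :: "int^'n^'m \<Rightarrow> real^'m \<Rightarrow> real"
  where "facet_width A b = min_width (rows (real_matrix A)) (polyhedron_of A b)"

end

theory Submission
  imports Defs
begin

text \<open>
  Write \<open>a\<^sub>i\<close> for the rows of \<open>A\<close>. Fix a nonzero integer vector \<open>z\<close> and let \<open>v\<close> maximise \<open>z \<bullet> x\<close>
  over \<open>P\<close>. By linear programming duality \<open>z\<close> is a nonnegative combination of the rows that are
  tight at \<open>v\<close> (\<open>maximizer_imp_in_cone_of_tight_rows\<close>), and by Caratheodory's theorem for cones
  these rows may be taken linearly independent (\<open>conic_caratheodory\<close>):
  \<open>z = (\<Sum>i\<in>I. u\<^sub>i a\<^sub>i)\<close> with \<open>u\<^sub>i \<ge> 0\<close>.

  Extend the rows in \<open>I\<close> to a basis of rows. Cramer's rule shows that each \<open>u\<^sub>i\<close> is a quotient of an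
  integer by an \<open>n \<times> n\<close> minor of \<open>A\<close>, so a nonzero \<open>u\<^sub>i\<close> is at least \<open>1 / \<Delta>\<close>
  (\<open>coefficient_ge_inverse_max_minor\<close>).

  For every \<open>y \<in> P\<close> all slacks \<open>a\<^sub>i \<bullet> v - a\<^sub>i \<bullet> y\<close> with \<open>i \<in> I\<close> are nonnegative, because \<open>a\<^sub>i\<close> is
  tight at \<open>v\<close>. Their combination with coefficients \<open>u\<^sub>i\<close> is \<open>z \<bullet> v - z \<bullet> y\<close>, which is at most the
  width along \<open>z\<close>. Hence for any single \<open>i\<close> with \<open>u\<^sub>i > 0\<close>, each slack of \<open>a\<^sub>i\<close> is at most \<open>\<Delta>\<close> times
  the width along \<open>z\<close>. The largest slack of \<open>a\<^sub>i\<close> is the width of \<open>P\<close> along \<open>a\<^sub>i\<close>, so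
  this one facet normal already has small enough width (\<open>row_width_le_max_minor_width\<close>).
\<close>

section \<open>Finitely generated cones\<close>

lemma convex_cone_hull_finite_explicit:
  fixes S :: "'a::euclidean_space set"
  assumes "finite S" "x \<in> convex_cone hull S"
  obtains u where "\<And>s. s \<in> S \<Longrightarrow> 0 \<le> u s" "x = (\<Sum>s\<in>S. u s *\<^sub>R s)"
proof (cases "x = 0")
  case True
  then show ?thesis
    using that[of "\<lambda>_. 0"] by simp
next
  case False
  then obtain c y where c: "0 \<le> c" "x = c *\<^sub>R y" and y: "y \<in> convex hull S"
    using assms(2) unfolding convex_cone_hull_convex_hull by auto
  from y obtain w where w: "\<And>s. s \<in> S \<Longrightarrow> 0 \<le> w s" "(\<Sum>s\<in>S. w s *\<^sub>R s) = y"
    using convex_hull_finite[OF assms(1)] by auto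
  show ?thesis
  proof (rule that[of "\<lambda>s. c * w s"])
    show "x = (\<Sum>s\<in>S. (c * w s) *\<^sub>R s)"
      unfolding c(2) w(2)[symmetric] by (simp add: scaleR_sum_right)
  qed (use c w in auto)
qed

lemma sum_nonneg_in_convex_cone_hull:
  fixes S :: "'a::euclidean_space set"
  assumes "finite S" "\<And>s. s \<in> S \<Longrightarrow> 0 \<le> u s" "S \<subseteq> T"
  shows "(\<Sum>s\<in>S. u s *\<^sub>R s) \<in> convex_cone hull T"
  using assms
proof (induction S rule: finite_induct)
  case empty
  then show ?case by (simp add: convex_cone_hull_contains_0)
next
  case (insert s S)
  have "u s *\<^sub>R s \<in> convex_cone hull T"
    using insert.prems by (intro convex_cone_hull_mul hull_inc) auto
  with insert show ?case
    by (simp add: convex_cone_hull_add)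
qed

text \<open>
  Take a generating subset of least cardinality. If it were dependent, subtracting a suitable
  multiple of a linear relation would make one coefficient vanish and keep the others
  nonnegative, so that one generator could be dropped.
\<close>
lemma conic_caratheodory:
  fixes S :: "'a::euclidean_space set"
  assumes "finite S" "x \<in> convex_cone hull S"
  obtains T where "T \<subseteq> S" "independent T" "x \<in> convex_cone hull T"
proof -
  let ?Q = "\<lambda>T. T \<subseteq> S \<and> x \<in> convex_cone hull T"
  obtain T where T: "?Q T" and min: "\<And>T'. ?Q T' \<Longrightarrow> card T \<le> card T'"
    using ex_has_least_nat[of ?Q S card] assms(2) by blast
  have fin: "finite T"
    using T assms(1) finite_subset by blast
  have "independent T"
  proof
    assume "dependent T"
    then obtain v0 where v0: "(\<Sum>s\<in>T. v0 s *\<^sub>R s) = 0" "\<exists>s\<in>T. v0 s \<noteq> 0"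
      using fin real_vector.dependent_finite by blast
    obtain v where v: "(\<Sum>s\<in>T. v s *\<^sub>R s) = 0" "\<exists>s\<in>T. v s > 0"
    proof (cases "\<exists>s\<in>T. v0 s > 0")
      case True
      with v0 that show ?thesis by blast
    next
      case False
      with v0 have "(\<Sum>s\<in>T. (- v0 s) *\<^sub>R s) = 0" "\<exists>s\<in>T. - v0 s > 0"
        by (auto simp: sum_negf neq_iff)
      then show ?thesis by (rule that)
    qed
    obtain u where u: "\<And>s. s \<in> T \<Longrightarrow> 0 \<le> u s" "x = (\<Sum>s\<in>T. u s *\<^sub>R s)"
      using convex_cone_hull_finite_explicit[OF fin] T by blast
    let ?V = "{s \<in> T. v s > 0}"
    obtain s0 where s0: "s0 \<in> ?V" and s0_min: "\<And>s. s \<in> ?V \<Longrightarrow> u s0 / v s0 \<le> u s / v s"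
    proof -
      have "finite ?V" "?V \<noteq> {}" using fin v by auto
      then show ?thesis
        using ex_is_arg_min_if_finite[of ?V "\<lambda>s. u s / v s"] that
        unfolding is_arg_min_linorder by blast
    qed
    \<comment> \<open>the largest multiple of the relation that can be subtracted with all coefficients
        staying nonnegative; at \<open>s0\<close> the coefficient reaches zero\<close>
    define t where "t = u s0 / v s0"
    define u' where "u' = (\<lambda>s. u s - t * v s)"
    have t0: "0 \<le> t" using s0 u by (auto simp: t_def)
    have u'_nonneg: "0 \<le> u' s" if "s \<in> T" for s
    proof (cases "v s > 0")
      case True
      then show ?thesis
        using s0_min[of s] that by (simp add: u'_def t_def pos_le_divide_eq)
    next
      case False
      then have "t * v s \<le> 0" using t0 by (simp add: mult_nonneg_nonpos)
      then show ?thesis using u(1)[OF that] by (simp add: u'_def)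
    qed
    have u'_s0: "u' s0 = 0" using s0 by (simp add: u'_def t_def)
    have "x = (\<Sum>s\<in>T. u' s *\<^sub>R s)"
    proof -
      have "(\<Sum>s\<in>T. u' s *\<^sub>R s) = (\<Sum>s\<in>T. u s *\<^sub>R s) - t *\<^sub>R (\<Sum>s\<in>T. v s *\<^sub>R s)"
        by (simp add: u'_def scaleR_diff_left sum_subtractf scaleR_sum_right)
      then show ?thesis using u v by simp
    qed
    also have "\<dots> = (\<Sum>s\<in>T - {s0}. u' s *\<^sub>R s)"
      using fin u'_s0 by (intro sum.mono_neutral_right) auto
    also have "\<dots> \<in> convex_cone hull (T - {s0})"
      using fin u'_nonneg by (intro sum_nonneg_in_convex_cone_hull) auto
    finally have "?Q (T - {s0})" using T by blast
    then have "card T \<le> card (T - {s0})" by (rule min)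
    then show False using s0 card_Diff1_less[OF fin, of s0] by simp
  qed
  with T that show ?thesis by blast
qed

section \<open>Optimality in a polyhedron\<close>

lemma matrix_vector_mult_nth_row:
  fixes M :: "real^'n^'m"
  shows "(M *v x) $ i = row i M \<bullet> x"
  by (simp add: matrix_vector_mult_def row_def inner_vec_def)

text \<open>
  Otherwise a hyperplane separates \<open>z\<close> from the closed cone of the tight rows. Its normal gives a
  direction along which no tight constraint increases but \<open>z\<close> does; the other constraints
  have room for a short step, which contradicts the maximality of \<open>v\<close>.
\<close>
lemma maximizer_imp_in_cone_of_tight_rows:
  fixes A :: "int^'n^'m"
  defines "M \<equiv> real_matrix A"
  assumes v: "v \<in> polyhedron_of A b"
    and max: "\<And>y. y \<in> polyhedron_of A b \<Longrightarrow> z \<bullet> y \<le> z \<bullet> v"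
  shows "z \<in> convex_cone hull {row i M | i. row i M \<bullet> v = b $ i}"
proof (rule ccontr)
  let ?K = "{row i M | i. row i M \<bullet> v = b $ i}"
  assume "z \<notin> convex_cone hull ?K"
  moreover have "closed (convex_cone hull ?K)"
    by (intro closed_convex_cone_hull) simp
  ultimately obtain a c where a: "a \<bullet> z < c" "\<forall>x\<in>convex_cone hull ?K. c < a \<bullet> x"
    using separating_hyperplane_closed_point[OF convex_convex_cone_hull] by blast
  have c0: "c < 0" using a(2) convex_cone_hull_contains_0 by fastforce
  have az: "a \<bullet> z < 0" using a(1) c0 by simp
  \<comment> \<open>on a cone a linear functional that is bounded below is nonnegative\<close>
  have tight: "0 \<le> a \<bullet> row i M" if "row i M \<bullet> v = b $ i" for i
  proof (rule ccontr)
    assume neg: "\<not> 0 \<le> a \<bullet> row i M"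
    have "row i M \<in> convex_cone hull ?K" using that by (auto intro!: hull_inc)
    then have "(c / (a \<bullet> row i M)) *\<^sub>R row i M \<in> convex_cone hull ?K"
      using c0 neg by (intro convex_cone_hull_mul) (auto simp: divide_nonpos_nonpos)
    then have "c < a \<bullet> ((c / (a \<bullet> row i M)) *\<^sub>R row i M)" using a(2) by blast
    then show False using neg by simp
  qed
  \<comment> \<open>a short step from \<open>v\<close> in direction \<open>- a\<close> stays in the polyhedron\<close>
  have "\<forall>\<^sub>F e in at_right 0. row i M \<bullet> (v - e *\<^sub>R a) \<le> b $ i" for i
  proof (cases "row i M \<bullet> v = b $ i")
    case True
    have "row i M \<bullet> (v - e *\<^sub>R a) \<le> b $ i" if "0 < e" for e
      using tight[OF True] True that by (simp add: inner_diff_right inner_commute)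
    then show ?thesis
      by (auto simp: eventually_at_right_field intro: exI[of _ 1])
  next
    case False
    then have "row i M \<bullet> v < b $ i"
      using v by (simp add: polyhedron_of_def M_def matrix_vector_mult_nth_row order_less_le)
    moreover have "((\<lambda>e. row i M \<bullet> (v - e *\<^sub>R a)) \<longlongrightarrow> row i M \<bullet> (v - 0 *\<^sub>R a)) (at_right 0)"
      by (intro tendsto_intros)
    ultimately have "\<forall>\<^sub>F e in at_right 0. row i M \<bullet> (v - e *\<^sub>R a) < b $ i"
      by (intro order_tendstoD(2)) auto
    then show ?thesis by eventually_elim simp
  qed
  then have "\<forall>\<^sub>F e in at_right 0. \<forall>i. row i M \<bullet> (v - e *\<^sub>R a) \<le> b $ i"
    by (intro eventually_all_finite)
  then have "\<forall>\<^sub>F e in at_right 0. 0 < e \<and> v - e *\<^sub>R a \<in> polyhedron_of A b"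
    using eventually_at_right_less[of "0::real"]
    by eventually_elim (simp add: polyhedron_of_def M_def matrix_vector_mult_nth_row)
  then obtain e where e: "0 < e" "v - e *\<^sub>R a \<in> polyhedron_of A b"
    using eventually_happens trivial_limit_at_right_real by blast
  have "0 < e * - (a \<bullet> z)" using e(1) az by (intro mult_pos_pos) auto
  then show False using max[OF e(2)] by (simp add: inner_diff_right inner_commute)
qed

section \<open>Integrality of basic solutions\<close>

lemma det_of_int_matrix: "det (map_matrix of_int B :: 'a::comm_ring_1^'n^'n) = of_int (det B)"
  by (simp add: det_def)

lemma abs_minor_le_max_minor:
  fixes A :: "int^'n^'m" and f :: "'n \<Rightarrow> 'm"
  assumes "inj f"
  shows "\<bar>det (\<chi> i. row (f i) A)\<bar> \<le> max_minor A"
  unfolding max_minor_def using assms by (intro Max_ge) auto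

text \<open>
  The rows in \<open>T\<close> are part of a nonsingular square submatrix, which represents \<open>z\<close> with
  the same coefficients, extended by zeros. In Cramer's rule for such a coefficient the
  denominator is a minor of \<open>A\<close>, and the numerator is an integer because \<open>z\<close> is integral; if the
  coefficient is nonzero, the numerator is at least one in absolute value.
\<close>
lemma coefficient_ge_inverse_max_minor:
  fixes A :: "int^'n^'m"
  defines "M \<equiv> real_matrix A"
  assumes rank: "rank M = CARD('n)"
    and T: "T \<subseteq> rows M" "independent T"
    and z_int: "\<And>j. z $ j \<in> \<int>"
    and z: "z = (\<Sum>t\<in>T. u t *\<^sub>R t)"
    and t: "t \<in> T" "u t \<noteq> 0"
  shows "1 \<le> real_of_int (max_minor A) * \<bar>u t\<bar>"
proof -
  obtain B where B: "T \<subseteq> B" "B \<subseteq> rows M" "independent B" "rows M \<subseteq> span B"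
    using real_vector.maximal_independent_subset_extend[OF T] by blast
  have finB: "finite B" using B(3) by (rule independent_imp_finite)
  have cardB: "card B = CARD('n)"
    using basis_card_eq_dim[OF B(2) B(4) B(3)] rank by (simp add: row_rank_def)
  then obtain g :: "'n \<Rightarrow> real^'n" where g: "bij_betw g UNIV B"
    using finite_same_card_bij[OF finite finB] by force
  have g_B: "g i \<in> B" for i using g by (auto simp: bij_betw_def)
  define f where "f = (\<lambda>i. SOME k. row k M = g i)"
  have f: "row (f i) M = g i" for i
  proof -
    have "g i \<in> rows M" using g_B B(2) by blast
    then obtain k where "g i = row k M" unfolding rows_def by blast
    then show ?thesis unfolding f_def by (metis (mono_tags, lifting) someI)
  qed
  have "inj f"
    using g f by (metis bij_betw_imp_inj_on injD injI)
  define D where "D = (\<chi> i. row (f i) A)"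
  let ?D = "real_matrix D"
  have row_D: "row i ?D = g i" for i
    unfolding f[symmetric] by (simp add: vec_eq_iff D_def M_def row_def)
  have "rows ?D = B"
    using g by (auto simp: rows_def row_D bij_betw_def)
  then have "rank ?D = CARD('n)"
    using B(3) cardB by (simp add: row_rank_def dim_eq_card_independent)
  then have det_nz: "det ?D \<noteq> 0"
    using det_eq_0_rank[of ?D] by simp
  obtain k where k: "g k = t"
    using g t(1) B(1) unfolding bij_betw_def by blast
  define x :: "real^'n" where "x = (\<chi> i. if g i \<in> T then u (g i) else 0)"
  have z_rows: "z = (\<Sum>i\<in>UNIV. x $ i *s row i ?D)"
  proof -
    have "z = (\<Sum>s\<in>B. (if s \<in> T then u s else 0) *\<^sub>R s)"
      unfolding z using B(1) finB by (intro sum.mono_neutral_cong_left) auto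
    also have "\<dots> = (\<Sum>i\<in>UNIV. (if g i \<in> T then u (g i) else 0) *\<^sub>R g i)"
      by (rule sum.reindex_bij_betw[OF g, symmetric])
    finally show ?thesis by (simp add: x_def row_D scalar_mult_eq_scaleR)
  qed
  \<comment> \<open>Cramer's rule: the coefficient times the minor is the determinant of the
      integer matrix \<open>E\<close>; the floors are exact since \<open>z\<close> is integral\<close>
  define E where "E = (\<chi> i. if i = k then (\<chi> j. \<lfloor>z $ j\<rfloor>) else row i D)"
  have "real_matrix E = (\<chi> i. if i = k then z else row i ?D)"
    using z_int by (auto simp: E_def vec_eq_iff row_def Ints_def)
  then have "det (real_matrix E) = x $ k * det ?D"
    unfolding cramer_lemma_transpose[of k x ?D, symmetric] z_rows by simp
  then have cramer: "of_int (det E) = u t * of_int (det D)"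
    using k t(1) by (simp add: x_def det_of_int_matrix)
  then have "det E \<noteq> 0"
    using t(2) det_nz by (auto simp: det_of_int_matrix)
  then have "1 \<le> \<bar>real_of_int (det E)\<bar>" by linarith
  also have "\<dots> = of_int \<bar>det D\<bar> * \<bar>u t\<bar>"
    by (simp add: cramer abs_mult)
  also have "\<dots> \<le> real_of_int (max_minor A) * \<bar>u t\<bar>"
    using abs_minor_le_max_minor[OF \<open>inj f\<close>, of A] unfolding D_def
    by (intro mult_right_mono) auto
  finally show ?thesis .
qed

section \<open>Widths\<close>

lemma compact_imp_bdd_inner_image:
  fixes P :: "(real^'n) set"
  assumes "compact P"
  shows "bdd_above ((\<bullet>) z ` P)" "bdd_below ((\<bullet>) z ` P)"
proof -
  have "compact ((\<bullet>) z ` P)"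
    using assms by (intro compact_continuous_image continuous_intros)
  then show "bdd_above ((\<bullet>) z ` P)" "bdd_below ((\<bullet>) z ` P)"
    by (auto intro: bounded_imp_bdd_above bounded_imp_bdd_below compact_imp_bounded)
qed

lemma width_along_ge_diff:
  assumes "compact P" "x \<in> P" "y \<in> P"
  shows "z \<bullet> x - z \<bullet> y \<le> width_along z P"
  unfolding width_along_def using assms compact_imp_bdd_inner_image[OF assms(1)]
  by (intro diff_mono cSUP_upper cINF_lower) auto

lemma width_along_le:
  assumes "P \<noteq> {}" "\<And>x y. x \<in> P \<Longrightarrow> y \<in> P \<Longrightarrow> z \<bullet> x - z \<bullet> y \<le> c"
  shows "width_along z P \<le> c"
proof -
  have "(SUP x\<in>P. z \<bullet> x) - c \<le> z \<bullet> y" if "y \<in> P" for y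
    using cSUP_least[OF assms(1), of "\<lambda>x. z \<bullet> x" "z \<bullet> y + c"] assms(2)[OF _ that] by force
  then have "(SUP x\<in>P. z \<bullet> x) - c \<le> (INF y\<in>P. z \<bullet> y)"
    using assms(1) by (intro cINF_greatest)
  then show ?thesis by (simp add: width_along_def)
qed

text \<open>
  The row \<open>t\<close> is any one with positive coefficient in a basic representation of \<open>z\<close> at a maximiser
  \<open>v\<close>. Since \<open>v\<close> also maximises \<open>t\<close> over \<open>P\<close>, the width along \<open>t\<close> is controlled by the slacks
  \<open>t \<bullet> v - t \<bullet> y\<close> alone. The positivity of the largest minor is recorded to allow
  division by it later.
\<close>
lemma row_width_le_max_minor_width:
  fixes A :: "int^'n^'m" and b :: "real^'m"
  defines "M \<equiv> real_matrix A" and "P \<equiv> polyhedron_of A b"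
  assumes rank: "rank M = CARD('n)"
    and P: "compact P" "P \<noteq> {}"
    and z: "\<And>j. z $ j \<in> \<int>" "z \<noteq> 0"
  obtains t where "t \<in> rows M" "width_along t P \<le> real_of_int (max_minor A) * width_along z P"
    "0 < max_minor A"
proof -
  obtain v where v: "v \<in> P" "\<And>y. y \<in> P \<Longrightarrow> z \<bullet> y \<le> z \<bullet> v"
    using continuous_attains_sup[OF P, of "\<lambda>x. z \<bullet> x"]
      continuous_on_inner[OF continuous_on_const continuous_on_id, of P z] by auto
  let ?K = "{row i M | i. row i M \<bullet> v = b $ i}"
  have "z \<in> convex_cone hull ?K"
    using maximizer_imp_in_cone_of_tight_rows[of v A b z] v by (simp add: M_def P_def)
  then obtain T where T: "T \<subseteq> ?K" "independent T" "z \<in> convex_cone hull T"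
    using conic_caratheodory[of ?K z] by auto
  have finT: "finite T" using T(2) by (rule independent_imp_finite)
  obtain u where u: "\<And>s. s \<in> T \<Longrightarrow> 0 \<le> u s" "z = (\<Sum>s\<in>T. u s *\<^sub>R s)"
    using convex_cone_hull_finite_explicit[OF finT T(3)] by blast
  obtain t where t: "t \<in> T" "u t \<noteq> 0"
    using z(2) u(2) by (metis (no_types, lifting) scaleR_eq_0_iff sum.neutral)
  have T_rows: "T \<subseteq> rows M" using T(1) by (auto simp: rows_def)
  have ut: "1 \<le> real_of_int (max_minor A) * u t"
    using coefficient_ge_inverse_max_minor[of A T z u t] rank T_rows T(2) z(1) u t
    by (simp add: M_def)
  then have "0 < real_of_int (max_minor A) * u t" by linarith
  then have pos: "0 < max_minor A"
    using u(1)[OF t(1)] by (simp add: zero_less_mult_iff)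
  have tight: "s \<bullet> y \<le> s \<bullet> v" if "s \<in> T" "y \<in> P" for s y
    using T(1) that by (auto simp: P_def polyhedron_of_def M_def matrix_vector_mult_nth_row)
  have slack: "u t * (t \<bullet> v - t \<bullet> y) \<le> width_along z P" if y: "y \<in> P" for y
  proof -
    have "u t * (t \<bullet> v - t \<bullet> y) \<le> (\<Sum>s\<in>T. u s * (s \<bullet> v - s \<bullet> y))"
      using t(1) finT u(1) tight[OF _ y]
      by (intro member_le_sum[of t T "\<lambda>s. u s * (s \<bullet> v - s \<bullet> y)"]) auto
    also have "\<dots> = z \<bullet> v - z \<bullet> y"
      unfolding u(2) by (simp add: inner_sum_left right_diff_distrib sum_subtractf)
    also have "\<dots> \<le> width_along z P"
      using width_along_ge_diff[OF P(1) v(1) y] .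
    finally show ?thesis .
  qed
  have "width_along t P \<le> real_of_int (max_minor A) * width_along z P"
  proof (rule width_along_le[OF P(2)])
    fix x y assume x: "x \<in> P" and y: "y \<in> P"
    have nonneg: "0 \<le> t \<bullet> v - t \<bullet> y" using tight[OF t(1) y] by simp
    have "t \<bullet> x - t \<bullet> y \<le> 1 * (t \<bullet> v - t \<bullet> y)" using tight[OF t(1) x] by simp
    also have "\<dots> \<le> (real_of_int (max_minor A) * u t) * (t \<bullet> v - t \<bullet> y)"
      using ut nonneg by (rule mult_right_mono)
    also have "\<dots> \<le> real_of_int (max_minor A) * width_along z P"
      using slack[OF y] pos by simp
    finally show "t \<bullet> x - t \<bullet> y \<le> real_of_int (max_minor A) * width_along z P" .
  qed
  then show ?thesis using that t(1) T_rows pos by blast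
qed

theorem proposition1p9:
  fixes A :: "int^'n^'m" and b :: "real^'m" and P :: "(real^'n) set" and \<Delta> :: int
  assumes "CARD('m) \<ge> CARD('n)"
    and "rank (real_matrix A) = CARD('n)"
    and "P = polyhedron_of A b"
    and "polytope P"
    and "\<And>i. row_face A b i facet_of P"
    and "\<Delta> = max_minor A"
  shows "facet_width A b \<le> real_of_int \<Delta> * lattice_width P"
proof -
  let ?R = "rows (real_matrix A)" and ?Z = "{z :: real^'n. (\<forall>i. z $ i \<in> \<int>) \<and> z \<noteq> 0}"
  have compact: "compact P" using assms(4) by (rule polytope_imp_compact)
  have nonempty: "P \<noteq> {}"
    using assms(5) unfolding facet_of_def by (metis face_of_imp_subset subset_empty)
  have finite_rows: "finite ?R"
  proof -
    have "?R = range (\<lambda>i. row i (real_matrix A))" by (auto simp: rows_def)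
    then show ?thesis by simp
  qed
  have bound: "0 < \<Delta> \<and> facet_width A b \<le> real_of_int \<Delta> * width_along z P" if z: "z \<in> ?Z" for z
  proof -
    obtain t where t: "t \<in> ?R" "width_along t P \<le> real_of_int \<Delta> * width_along z P" "0 < \<Delta>"
      using row_width_le_max_minor_width[OF assms(2), of b z] compact nonempty z
      unfolding assms(3,6) by blast
    have "facet_width A b \<le> width_along t P"
      unfolding facet_width_def min_width_def assms(3)
      using t(1) by (intro cINF_lower bdd_below_finite finite_imageI) (use finite_rows in auto)
    then show ?thesis using t by linarith
  qed
  have one: "(1 :: real^'n) \<in> ?Z" by (simp add: vec_eq_iff)
  have pos: "0 < \<Delta>" using bound[OF one] by blast
  have "facet_width A b / real_of_int \<Delta> \<le> lattice_width P"
    unfolding lattice_width_def min_width_def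
  proof (rule cINF_greatest)
    show "?Z \<noteq> {}" using one by blast
    show "facet_width A b / real_of_int \<Delta> \<le> width_along z P" if "z \<in> ?Z" for z
      using bound[OF that] pos by (simp add: pos_divide_le_eq mult.commute)
  qed
  then show ?thesis using pos by (simp add: pos_divide_le_eq mult.commute)
qed

end
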